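(* For each $n\ge 3$ let $r_n=\sup_P \dfrac{2\,\mathrm{FWP}(P)}{\mathrm{MTSP}(P)}$, the supremum taken over all (multi)sets $P$ of $n$ points in $\mathbb{R}^2$ with $\mathrm{MTSP}(P)>0$. Then $r_n\to 2/\sqrt{3}$ as $n\to\infty$.
   Context: For a finite (multi)set $P\subset\mathbb{R}^2$, $\mathrm{FWP}(P)=\min_{c\in\mathbb{R}^2}\sum_{p\in P} d(c,p)$ with $d$ the Euclidean distance (the Fermat–Weber value of $P$), and $\mathrm{MTSP}(P)$ is the maximum total Euclidean length of a Hamiltonian cycle (tour) through all points of $P$ (the Maximum Traveling Salesman Problem). *)

theory Defs
  imports "HOL-Analysis.Analysis" "HOL-Combinatorics.Permutations"
begin

text \<open>A (multi)set of n points in the plane is an indexed family P 0, ..., P (n-1) in real^2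
  (repeated points allowed).\<close>

definition FWP :: "nat \<Rightarrow> (nat \<Rightarrow> real^2) \<Rightarrow> real" where
  "FWP n P = (INF c. \<Sum>i<n. dist c (P i))"

definition tour_length :: "nat \<Rightarrow> (nat \<Rightarrow> real^2) \<Rightarrow> (nat \<Rightarrow> nat) \<Rightarrow> real" where
  "tour_length n P s = (\<Sum>i<n. dist (P (s i)) (P (s (Suc i mod n))))"

definition MTSP :: "nat \<Rightarrow> (nat \<Rightarrow> real^2) \<Rightarrow> real" where
  "MTSP n P = Max ((tour_length n P) ` {s. s permutes {..<n}})"

definition r :: "nat \<Rightarrow> real" where
  "r n = Sup {2 * FWP n P / MTSP n P | P. MTSP n P > 0}"

end

theory Submission
  imports Defs
begin

text \<open>
  Lower bound: distribute the points evenly over the vertices of an equilateral triangle.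

  Upper bound: for points in general position, an intermediate value argument yields three median
  lines through a common point \<open>c\<close>, at mutual angles of 60 degrees. They cut the plane into six
  sectors, and opposite sectors contain the same number of points up to a constant. Points \<open>p\<close>, \<open>q\<close>
  of opposite sectors are seen from \<open>c\<close> under an angle of at least 120 degrees, so
  \<open>|p - q| \<ge> (sqrt 3 / 2) (|p - c| + |q - c|)\<close>. A tour that alternates between opposite sectors
  therefore has length about \<open>sqrt 3\<close> times the star of \<open>c\<close>, which is at least
  \<open>sqrt 3 * FWP\<close>. The boundedly many junctions and leftover points are separated by boundedly many
  points close to \<open>c\<close>, chosen in the largest pair of sectors, which costs only a fraction \<open>O(1/n)\<close>
  of the star. Arbitrary families are limits of families in general position, along
  \<open>P i + e (i, i^2)\<close>.
\<close>

section \<open>Medians\<close>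

text \<open>For \<open>n > 0\<close> this is the least \<open>t\<close> such that at least half of
  the values are at most \<open>t\<close>. The min-max form makes it a minimum over a finite family;
  \<open>lower_median_attained\<close> and \<open>lower_median_le\<close> recover the threshold
  description.\<close>

definition lower_median :: "nat \<Rightarrow> (nat \<Rightarrow> real) \<Rightarrow> real" where
  "lower_median n x = Min ((\<lambda>A. Max (x ` A)) ` {A. A \<subseteq> {..<n} \<and> n \<le> 2 * card A})"

text \<open>The midpoint of the median interval, whose upper end is the negated lower median of the
  negated values. It is exactly odd under negation, as the sign change in
  \<open>concurrent_medians\<close> requires.\<close>

definition central_median :: "nat \<Rightarrow> (nat \<Rightarrow> real) \<Rightarrow> real" where
  "central_median n x = (lower_median n x - lower_median n (\<lambda>i. - x i)) / 2"

lemma lower_median_attained: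
  assumes "n > 0"
  shows "n \<le> 2 * card {i. i < n \<and> x i \<le> lower_median n x}"
proof -
  let ?F = "{A. A \<subseteq> {..<n} \<and> n \<le> 2 * card A}"
  have "finite ?F" by simp
  moreover have "{..<n} \<in> ?F" by simp
  ultimately have "lower_median n x \<in> (\<lambda>A. Max (x ` A)) ` ?F"
    unfolding lower_median_def by (intro Min_in) auto
  then obtain A where A: "A \<subseteq> {..<n}" "n \<le> 2 * card A" "lower_median n x = Max (x ` A)"
    by auto
  have "finite A" using A(1) finite_subset by blast
  then have "A \<subseteq> {i. i < n \<and> x i \<le> lower_median n x}"
    using A by auto
  then have "card A \<le> card {i. i < n \<and> x i \<le> lower_median n x}"
    by (intro card_mono) auto
  with A(2) show ?thesis by linarith
qed

lemma lower_median_le: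
  assumes "n > 0" "n \<le> 2 * card {i. i < n \<and> x i \<le> t}"
  shows "lower_median n x \<le> t"
proof -
  let ?A = "{i. i < n \<and> x i \<le> t}"
  have "?A \<noteq> {}" using assms by (metis card.empty mult_0_right not_le)
  have "lower_median n x \<le> Max (x ` ?A)"
    unfolding lower_median_def using assms(2) by (intro Min_le) auto
  also have "\<dots> \<le> t" using \<open>?A \<noteq> {}\<close> by (subst Max_le_iff) auto
  finally show ?thesis .
qed

lemma lower_median_shift:
  assumes "n > 0" "\<And>i. i < n \<Longrightarrow> x i \<le> y i + e"
  shows "lower_median n x \<le> lower_median n y + e"
proof (rule lower_median_le[OF assms(1)])
  have "card {i. i < n \<and> y i \<le> lower_median n y} \<le> card {i. i < n \<and> x i \<le> lower_median n y + e}"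
    using assms(2) by (intro card_mono) force+
  with lower_median_attained[OF assms(1), of y]
  show "n \<le> 2 * card {i. i < n \<and> x i \<le> lower_median n y + e}" by linarith
qed

text \<open>Moving each value by at most \<open>e\<close> moves either end of the median interval by
  at most \<open>e\<close>. This will make the offset of a median line continuous in its
  angle.\<close>

lemma central_median_lipschitz:
  assumes "n > 0" "\<And>i. i < n \<Longrightarrow> \<bar>x i - y i\<bar> \<le> e"
  shows "\<bar>central_median n x - central_median n y\<bar> \<le> e"
proof -
  have h: "x i \<le> y i + e" "y i \<le> x i + e" "- x i \<le> - y i + e" "- y i \<le> - x i + e" if "i < n" for i
    using assms(2)[OF that] by auto
  show ?thesis
    using lower_median_shift[OF assms(1), of x y e] lower_median_shift[OF assms(1), of y x e]
      lower_median_shift[OF assms(1), of "\<lambda>i. - x i" "\<lambda>i. - y i" e]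
      lower_median_shift[OF assms(1), of "\<lambda>i. - y i" "\<lambda>i. - x i" e] h
    unfolding central_median_def by (auto simp: abs_le_iff field_simps)
qed

lemma central_median_uminus: "central_median n (\<lambda>i. - x i) = - central_median n x"
  by (simp add: central_median_def field_simps)

text \<open>A \<open>t\<close> strictly between the two in the wrong order would have fewer than
  half of the values on either closed side, although the two sides cover all indices.\<close>

lemma lower_median_le_upper_median:
  assumes "n > 0"
  shows "lower_median n x \<le> - lower_median n (\<lambda>i. - x i)"
proof (rule ccontr)
  assume "\<not> ?thesis"
  then obtain t where t: "- lower_median n (\<lambda>i. - x i) < t" "t < lower_median n x"
    using dense not_le by blast
  have 1: "2 * card {i. i < n \<and> x i \<le> t} < n"
    using lower_median_le[OF assms, of x t] t by linarith
  have 2: "2 * card {i. i < n \<and> - x i \<le> - t} < n"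
    using lower_median_le[OF assms, of "\<lambda>i. - x i" "-t"] t by linarith
  have "card {..<n} \<le> card ({i. i < n \<and> x i \<le> t} \<union> {i. i < n \<and> - x i \<le> - t})"
    by (intro card_mono) auto
  also have "\<dots> \<le> card {i. i < n \<and> x i \<le> t} + card {i. i < n \<and> - x i \<le> - t}"
    by (rule card_Un_le)
  finally show False using 1 2 by simp
qed

text \<open>At least half of the indices have values at or below the lower median, and these are
  disjoint from the indices above \<open>m\<close>.\<close>

lemma card_above_median:
  assumes "n > 0" "lower_median n x \<le> m"
  shows "2 * card {i. i < n \<and> x i > m} \<le> n"
proof -
  have "card {i. i < n \<and> x i > m} + card {i. i < n \<and> x i \<le> lower_median n x}
     = card ({i. i < n \<and> x i > m} \<union> {i. i < n \<and> x i \<le> lower_median n x})"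
    using assms(2) by (intro card_Un_disjoint[symmetric]) auto
  also have "\<dots> \<le> card {..<n}" by (intro card_mono) auto
  finally show ?thesis using lower_median_attained[OF assms(1), of x] by simp
qed

lemma central_median_balanced:
  assumes "n > 0"
  shows "2 * card {i. i < n \<and> x i > central_median n x} \<le> n"
    and "2 * card {i. i < n \<and> x i < central_median n x} \<le> n"
proof -
  note le = lower_median_le_upper_median[OF assms, of x]
  show "2 * card {i. i < n \<and> x i > central_median n x} \<le> n"
    using le by (intro card_above_median[OF assms]) (simp add: central_median_def)
  have "2 * card {i. i < n \<and> - x i > - central_median n x} \<le> n"
    using le by (intro card_above_median[OF assms, of "\<lambda>i. - x i"]) (simp add: central_median_def field_simps)
  then show "2 * card {i. i < n \<and> x i < central_median n x} \<le> n" by simp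
qed

section \<open>Concurrent median lines\<close>

definition dir :: "real \<Rightarrow> real^2" where
  "dir t = vector [cos t, sin t]"

lemma inner_dir: "x \<bullet> dir t = x $ 1 * cos t + x $ 2 * sin t"
  by (simp add: dir_def inner_vec_def sum_2)

lemma norm_dir: "norm (dir t) = 1"
  by (simp add: norm_eq_sqrt_inner inner_dir) (simp add: dir_def power2_eq_square[symmetric])

lemma dir_add_pi: "dir (t + pi) = - dir t"
  by (simp add: dir_def vec_eq_iff forall_2)

lemma cos_add_120: "cos (t + 2 * pi / 3) = - cos t / 2 - sqrt 3 / 2 * sin t"
  unfolding cos_add cos_120 sin_120 by simp

lemma sin_add_120: "sin (t + 2 * pi / 3) = sqrt 3 / 2 * cos t - sin t / 2"
  unfolding sin_add cos_120 sin_120 by simp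

text \<open>Two unit vectors at 120 degrees add up to the unit vector on their bisector. Hence the
  inner product with the middle direction is the sum of the outer two.\<close>

lemma dir_add_third: "dir t + dir (t + 2 * pi / 3) = dir (t + pi / 3)"
  by (simp add: dir_def vec_eq_iff forall_2 cos_add_120 sin_add_120 cos_add[of t "pi/3"]
      sin_add[of t "pi/3"] cos_60 sin_60)

lemma norm_via_dirs:
  "3/4 * (norm x)\<^sup>2 = (x \<bullet> dir t)\<^sup>2 + (x \<bullet> dir t) * (x \<bullet> dir (t + 2 * pi / 3)) + (x \<bullet> dir (t + 2 * pi / 3))\<^sup>2"
proof -
  \<comment> \<open>The coordinates of \<open>x\<close> in the orthonormal frame obtained by
    rotating the axes by \<open>t\<close>.\<close>
  define s r where "s = x $ 1 * cos t + x $ 2 * sin t" and "r = x $ 2 * cos t - x $ 1 * sin t"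
  have 1: "x \<bullet> dir t = s" by (simp add: inner_dir s_def)
  have 2: "x \<bullet> dir (t + 2 * pi / 3) = - s / 2 + sqrt 3 / 2 * r"
    unfolding inner_dir cos_add_120 sin_add_120 s_def r_def by (simp add: algebra_simps add_divide_distrib diff_divide_distrib)
  have "s\<^sup>2 + r\<^sup>2 = ((x $ 1)\<^sup>2 + (x $ 2)\<^sup>2) * ((cos t)\<^sup>2 + (sin t)\<^sup>2)"
    unfolding s_def r_def by algebra
  then have 3: "(norm x)\<^sup>2 = s\<^sup>2 + r\<^sup>2"
    unfolding power2_norm_eq_inner by (simp add: inner_vec_def sum_2 power2_eq_square)
  have q: "sqrt 3 * sqrt 3 = 3" by simp
  have "(- s / 2 + sqrt 3 / 2 * r)\<^sup>2 = s\<^sup>2 / 4 - sqrt 3 / 2 * s * r + (sqrt 3 * sqrt 3) / 4 * r\<^sup>2"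
    by (simp add: power2_eq_square algebra_simps)
  also have "\<dots> = s\<^sup>2 / 4 - sqrt 3 / 2 * s * r + 3 / 4 * r\<^sup>2" unfolding q by simp
  finally show ?thesis unfolding 1 2 3 by (simp add: power2_eq_square algebra_simps)
qed

lemma ex_inner_dirs:
  "\<exists>c::real^2. c \<bullet> dir t = a \<and> c \<bullet> dir (t + 2 * pi / 3) = b"
proof -
  define v w where "v = dir t" and "w = dir (t + 2 * pi / 3)"
  have d: "v \<bullet> v = 1" "w \<bullet> w = 1"
    by (simp_all add: v_def w_def norm_dir flip: power2_norm_eq_inner)
  have "(v + w) \<bullet> (v + w) = 1"
    unfolding v_def w_def dir_add_third by (simp add: norm_dir flip: power2_norm_eq_inner)
  then have e: "v \<bullet> w = - 1 / 2" "w \<bullet> v = - 1 / 2"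
    using d by (simp_all add: inner_add_left inner_add_right inner_commute)
  \<comment> \<open>The coefficients come from inverting the Gram matrix of \<open>v\<close> and
    \<open>w\<close>, which has diagonal entries 1 and off-diagonal entries -1/2.\<close>
  define c where "c = (4/3 * (a + b/2)) *\<^sub>R v + (4/3 * (b + a/2)) *\<^sub>R w"
  have "c \<bullet> v = a" "c \<bullet> w = b"
    by (simp_all add: c_def inner_add_left d e) (simp_all add: field_simps)
  then show ?thesis unfolding v_def w_def by blast
qed

lemma concurrent_medians:
  fixes P :: "nat \<Rightarrow> real^2"
  assumes "n > 0"
  obtains t c where
    "\<And>s. s \<in> {t, t + pi/3, t + 2*pi/3} \<Longrightarrow> 2 * card {i. i < n \<and> (P i - c) \<bullet> dir s > 0} \<le> n"
    "\<And>s. s \<in> {t, t + pi/3, t + 2*pi/3} \<Longrightarrow> 2 * card {i. i < n \<and> (P i - c) \<bullet> dir s < 0} \<le> n"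
proof -
  \<comment> \<open>The signed offset of the median line with normal \<open>dir s\<close>. Turning
    by \<open>pi\<close> gives the same line with the opposite normal, so the offset changes
    sign.\<close>
  define m where "m s = central_median n (\<lambda>i. P i \<bullet> dir s)" for s
  have m_pi: "m (s + pi) = - m s" for s
    by (simp add: m_def dir_add_pi central_median_uminus)
  have "isCont m s" for s
  proof -
    have lip: "\<bar>m s' - m s\<bar> \<le> (\<Sum>i<n. \<bar>P i \<bullet> dir s' - P i \<bullet> dir s\<bar>)" for s'
      unfolding m_def
      by (rule central_median_lipschitz[OF assms]) (auto intro: member_le_sum)
    have "((\<lambda>s'. \<Sum>i<n. \<bar>P i \<bullet> dir s' - P i \<bullet> dir s\<bar>) \<longlongrightarrow> (\<Sum>i<n. \<bar>P i \<bullet> dir s - P i \<bullet> dir s\<bar>)) (at s)"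
      unfolding inner_dir by (intro tendsto_intros)
    then have "((\<lambda>s'. \<Sum>i<n. \<bar>P i \<bullet> dir s' - P i \<bullet> dir s\<bar>) \<longlongrightarrow> 0) (at s)" by simp
    then have "((\<lambda>s'. m s' - m s) \<longlongrightarrow> 0) (at s)"
      by (rule Lim_null_comparison[rotated]) (use lip in auto)
    then show ?thesis by (simp add: isCont_def LIM_zero_iff)
  qed
  then have m_cont: "continuous_on S m" for S by (simp add: continuous_at_imp_continuous_on)
  \<comment> \<open>\<open>g\<close> measures the failure of the three median lines to be concurrent. Turning by \<open>pi / 3\<close>
    permutes the lines but reverses the sign of \<open>g\<close>.\<close>
  define g where "g s = m s - m (s + pi/3) + m (s + 2*pi/3)" for s
  have g_flip: "g (pi/3) = - g 0"
    using m_pi[of 0] by (simp add: g_def algebra_simps add_divide_distrib[symmetric])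
  have g_cont: "continuous_on {0..pi/3} g"
    unfolding g_def by (intro continuous_intros continuous_on_compose2[OF m_cont[of UNIV]]) auto
  have "\<exists>t. g t = 0"
  proof (cases "g 0 \<le> 0")
    case True
    then show ?thesis using IVT'[of g 0 0 "pi/3"] g_flip g_cont by auto
  next
    case False
    then show ?thesis using IVT2'[of g "pi/3" 0 0] g_flip g_cont by auto
  qed
  then obtain t where t: "g t = 0" ..
  \<comment> \<open>Intersect the two outer median lines. By \<open>dir_add_third\<close>,
    \<open>g t = 0\<close> says exactly that the middle line passes through the same point.\<close>
  obtain c where c: "c \<bullet> dir t = m t" "c \<bullet> dir (t + 2*pi/3) = m (t + 2*pi/3)"
    using ex_inner_dirs by blast
  have "c \<bullet> dir (t + pi/3) = m (t + pi/3)"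
    using c t by (simp add: g_def flip: dir_add_third) (simp add: inner_add_right)
  with c have cm: "c \<bullet> dir s = m s" if "s \<in> {t, t + pi/3, t + 2*pi/3}" for s
    using that by auto
  show thesis
  proof (rule that[of t c])
    fix s assume s: "s \<in> {t, t + pi/3, t + 2*pi/3}"
    show "2 * card {i. i < n \<and> (P i - c) \<bullet> dir s > 0} \<le> n"
      using central_median_balanced(1)[OF assms, of "\<lambda>i. P i \<bullet> dir s"] cm[OF s]
      by (simp add: inner_diff_left m_def)
    show "2 * card {i. i < n \<and> (P i - c) \<bullet> dir s < 0} \<le> n"
      using central_median_balanced(2)[OF assms, of "\<lambda>i. P i \<bullet> dir s"] cm[OF s]
      by (simp add: inner_diff_left m_def)
  qed
qed

section \<open>Path covers and tours\<close>

text \<open>Induction prepends a pair \<open>a\<close>, \<open>b\<close>. Requiring the path to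
  start in \<open>A\<close> supplies the edge from \<open>b\<close> to the old head.\<close>

lemma alternating_path:
  assumes "finite A" "finite B" "card A = card B" "A \<inter> B = {}"
    and "\<And>a b. a \<in> A \<Longrightarrow> b \<in> B \<Longrightarrow> E a b \<and> E b a"
  shows "\<exists>xs. distinct xs \<and> set xs = A \<union> B \<and> successively E xs \<and> (xs \<noteq> [] \<longrightarrow> hd xs \<in> A)"
  using assms
proof (induction A arbitrary: B rule: finite_induct)
  case empty
  then show ?case by (intro exI[of _ "[]"]) auto
next
  case (insert a A)
  then obtain b where b: "b \<in> B" by fastforce
  have "\<exists>xs. distinct xs \<and> set xs = A \<union> (B - {b}) \<and> successively E xs \<and> (xs \<noteq> [] \<longrightarrow> hd xs \<in> A)"
    by (rule insert.IH) (use insert.prems insert.hyps b in auto)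
  then obtain xs where xs: "distinct xs" "set xs = A \<union> (B - {b})" "successively E xs"
    "xs \<noteq> [] \<Longrightarrow> hd xs \<in> A" by blast
  show ?case
    by (rule exI[of _ "a # b # xs"])
      (use xs b insert.prems insert.hyps in \<open>auto simp: successively_Cons\<close>)
qed

text \<open>Only an upper bound on the number of paths is recorded, so that surpluses and
  exceptional points can be estimated crudely.\<close>

definition path_cover :: "('a \<Rightarrow> 'a \<Rightarrow> bool) \<Rightarrow> 'a set \<Rightarrow> nat \<Rightarrow> bool" where
  "path_cover E V m \<longleftrightarrow> (\<exists>bss. length bss \<le> m \<and> set (concat bss) = V \<and> distinct (concat bss) \<and>
     (\<forall>b \<in> set bss. successively E b))"

lemma path_cover_Un:
  assumes "path_cover E V k" "path_cover E W m" "V \<inter> W = {}"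
  shows "path_cover E (V \<union> W) (k + m)"
proof -
  obtain bs cs where "length bs \<le> k" "set (concat bs) = V" "distinct (concat bs)"
     "\<forall>b \<in> set bs. successively E b" "length cs \<le> m" "set (concat cs) = W" "distinct (concat cs)"
     "\<forall>b \<in> set cs. successively E b"
    using assms unfolding path_cover_def by blast
  with assms(3) show ?thesis
    unfolding path_cover_def by (intro exI[of _ "bs @ cs"]) auto
qed

lemma path_cover_card:
  assumes "finite V"
  shows "path_cover E V (card V)"
proof -
  obtain xs where xs: "set xs = V" "distinct xs" "length xs = card V"
    using finite_distinct_list[OF assms] distinct_card by metis
  have "concat (map (\<lambda>x. [x]) xs) = xs" by (induction xs) auto
  with xs show ?thesis
    unfolding path_cover_def by (intro exI[of _ "map (\<lambda>x. [x]) xs"]) auto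
qed

lemma path_cover_mono:
  assumes "path_cover E V k" "k \<le> m"
  shows "path_cover E V m"
proof -
  obtain bs where "length bs \<le> k" "set (concat bs) = V" "distinct (concat bs)"
     "\<forall>b \<in> set bs. successively E b"
    using assms(1) unfolding path_cover_def by blast
  with assms(2) show ?thesis unfolding path_cover_def by (intro exI[of _ bs]) simp
qed

text \<open>Equally many vertices of both sides form one alternating path. The surplus lies on one
  side only and contributes at most \<open>d\<close> single vertices.\<close>

lemma path_cover_bipartite:
  assumes "finite A" "finite B" "A \<inter> B = {}" "card A \<le> card B + d" "card B \<le> card A + d"
    and E: "\<And>a b. a \<in> A \<Longrightarrow> b \<in> B \<Longrightarrow> E a b \<and> E b a"
  shows "path_cover E (A \<union> B) (d + 1)"
proof -
  obtain A' where A': "A' \<subseteq> A" "card A' = min (card A) (card B)"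
    using obtain_subset_with_card_n[OF min.cobounded1] by metis
  obtain B' where B': "B' \<subseteq> B" "card B' = min (card A) (card B)"
    using obtain_subset_with_card_n[OF min.cobounded2] by metis
  have fin: "finite A'" "finite B'"
    using finite_subset[OF A'(1) assms(1)] finite_subset[OF B'(1) assms(2)] .
  have "\<exists>xs. distinct xs \<and> set xs = A' \<union> B' \<and> successively E xs \<and> (xs \<noteq> [] \<longrightarrow> hd xs \<in> A')"
  proof (rule alternating_path)
    show "E a b \<and> E b a" if "a \<in> A'" "b \<in> B'" for a b using that A' B' E by blast
  qed (use A' B' fin assms(3) in auto)
  then obtain xs where "distinct xs" "set xs = A' \<union> B'" "successively E xs" by blast
  then have 1: "path_cover E (A' \<union> B') 1"
    unfolding path_cover_def by (intro exI[of _ "[xs]"]) auto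
  have "card ((A - A') \<union> (B - B')) \<le> card (A - A') + card (B - B')" by (rule card_Un_le)
  also have "\<dots> = (card A - card A') + (card B - card B')"
    using A'(1) B'(1) fin by (simp add: card_Diff_subset)
  also have "\<dots> \<le> d" using A'(2) B'(2) assms(4,5) by (simp add: min_def split: if_splits)
  finally have "path_cover E ((A - A') \<union> (B - B')) d"
    using assms(1,2) by (intro path_cover_mono[OF path_cover_card]) auto
  then have "path_cover E (((A - A') \<union> (B - B')) \<union> (A' \<union> B')) (d + 1)"
    by (rule path_cover_Un[OF _ 1]) (use A' B' assms(3) in auto)
  moreover have "((A - A') \<union> (B - B')) \<union> (A' \<union> B') = A \<union> B" using A' B' by auto
  ultimately show ?thesis by simp
qed

text \<open>Each block is preceded by a vertex adjacent to everything. The claim about the head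
  keeps the induction going: the end of a block is joined to the next such vertex.\<close>

lemma successively_separated:
  assumes "length zs = length bss" "\<And>b. b \<in> set bss \<Longrightarrow> successively E b"
    "\<And>z v. z \<in> set zs \<Longrightarrow> E z v \<and> E v z"
  shows "successively E (concat (map2 (#) zs bss)) \<and>
    mset (concat (map2 (#) zs bss)) = mset zs + mset (concat bss) \<and>
    (zs \<noteq> [] \<longrightarrow> concat (map2 (#) zs bss) \<noteq> [] \<and> hd (concat (map2 (#) zs bss)) \<in> set zs)"
  using assms
proof (induction zs bss rule: list_induct2)
  case Nil
  then show ?case by simp
next
  case (Cons z zs b bss)
  then have IH: "successively E (concat (map2 (#) zs bss))"
    "mset (concat (map2 (#) zs bss)) = mset zs + mset (concat bss)"
    "zs \<noteq> [] \<Longrightarrow> hd (concat (map2 (#) zs bss)) \<in> set zs"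
    by auto
  define ws where "ws = concat (map2 (#) zs bss)"
  have "zs = [] \<Longrightarrow> ws = []" by (simp add: ws_def)
  then have "ws = [] \<or> E v (hd ws)" for v
    using IH(3) Cons.prems(2)[of "hd ws" v] unfolding ws_def[symmetric] by fastforce
  then show ?case
    using IH(1,2) Cons.prems unfolding ws_def[symmetric]
    by (auto simp: successively_Cons successively_append_iff ws_def[symmetric])
qed

text \<open>The vertices of \<open>Z\<close> act as hubs, one in front of each path. The cycle
  closes because its head is a hub.\<close>

lemma hamiltonian_of_path_cover:
  assumes "path_cover E (V - Z) (card Z)" "finite Z" "Z \<noteq> {}" "Z \<subseteq> V"
    "\<And>z v. z \<in> Z \<Longrightarrow> E z v \<and> E v z"
  shows "\<exists>xs. distinct xs \<and> set xs = V \<and> xs \<noteq> [] \<and> successively E xs \<and> E (last xs) (hd xs)"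
proof -
  obtain zs where zs: "set zs = Z" "distinct zs" "length zs = card Z"
    using finite_distinct_list[OF assms(2)] distinct_card by metis
  obtain bs where bs: "length bs \<le> card Z" "set (concat bs) = V - Z" "distinct (concat bs)"
     "\<And>b. b \<in> set bs \<Longrightarrow> successively E b"
    using assms(1) unfolding path_cover_def by blast
  \<comment> \<open>Padding with empty paths uses up all hubs; hubs are also adjacent to one
    another, so an empty path between them does no harm.\<close>
  define cs where "cs = bs @ replicate (card Z - length bs) []"
  have conc: "concat cs = concat bs"
    by (simp add: cs_def)
  define xs where "xs = concat (map2 (#) zs cs)"
  have "length zs = length cs" using zs bs by (simp add: cs_def)
  then have *: "successively E xs \<and> mset xs = mset zs + mset (concat cs) \<and>
    (zs \<noteq> [] \<longrightarrow> xs \<noteq> [] \<and> hd xs \<in> set zs)"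
    unfolding xs_def
    by (rule successively_separated) (use bs(4) assms(5) zs(1) in \<open>auto simp: cs_def\<close>)
  then have m: "mset xs = mset (zs @ concat bs)" by (simp add: conc)
  then have "distinct xs" using zs bs mset_eq_imp_distinct_iff[OF m] by auto
  moreover have "set xs = V" using mset_eq_setD[OF m] zs bs assms(4) by auto
  moreover have "zs \<noteq> []" using zs assms(3) by auto
  ultimately show ?thesis using * assms(5) zs(1) by (intro exI[of _ xs]) auto
qed

section \<open>Tour lengths from Hamiltonian cycles\<close>

lemma finite_tours: "finite (tour_length n P ` {s. s permutes {..<n}})"
  by (simp add: finite_permutations)

lemma tour_length_le_MTSP: "s permutes {..<n} \<Longrightarrow> tour_length n P s \<le> MTSP n P"
  unfolding MTSP_def by (rule Max_ge[OF finite_tours]) auto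

text \<open>Every vertex lies on two edges of the cycle, so summing the edge bounds counts each
  \<open>f i\<close> twice. Negative values of \<open>f\<close> are allowed, which leaves room for
  penalties.\<close>

lemma MTSP_ge_of_hamiltonian:
  assumes "distinct xs" "set xs = {..<n}" "xs \<noteq> []" "successively E xs" "E (last xs) (hd xs)"
    and E: "\<And>i j. E i j \<Longrightarrow> f i + f j \<le> dist (P i) (P j)"
  shows "2 * (\<Sum>i<n. f i) \<le> MTSP n P"
proof -
  have len: "length xs = n" using assms(1,2) distinct_card by fastforce
  then obtain m where m: "n = Suc m" using assms(3) by (cases n) auto
  define s where "s i = (if i < n then xs ! i else i)" for i
  have bij: "bij_betw ((!) xs) {..<n} {..<n}"
    by (rule bij_betw_nth) (use assms len in auto)
  then have "bij_betw s {..<n} {..<n}"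
    by (rule bij_betw_cong[THEN iffD1, rotated]) (simp add: s_def)
  then have perm: "s permutes {..<n}"
    by (rule bij_imp_permutes) (simp add: s_def)
  have reidx: "(\<Sum>i<n. f (xs ! i)) = (\<Sum>i<n. f i)"
    using sum.reindex_bij_betw[OF bij, of f] .
  have edge: "E (xs ! i) (xs ! (Suc i mod n))" if "i < n" for i
  proof (cases "Suc i < n")
    case True
    have "\<forall>i. Suc i < length xs \<longrightarrow> E (xs ! i) (xs ! Suc i)"
      using assms(4)
    proof (induction xs rule: induct_list012)
      case (3 x y zs)
      then show ?case by (auto simp: nth_Cons split: nat.split)
    qed auto
    then show ?thesis using True len by simp
  next
    case False
    then have "i = m" "Suc i = n" using that m by auto
    moreover have "last xs = xs ! m" using len m assms(3) by (simp add: last_conv_nth)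
    ultimately show ?thesis using assms(3,5) by (simp add: hd_conv_nth)
  qed
  \<comment> \<open>Cyclic shift: the successor of the last position \<open>m\<close> is position
    0.\<close>
  have "(\<Sum>i<n. f (xs ! (Suc i mod n))) = (\<Sum>i<m. f (xs ! Suc i)) + f (xs ! 0)"
    by (simp add: m)
  also have "\<dots> = (\<Sum>i<n. f (xs ! i))"
    unfolding m by (simp add: sum.lessThan_Suc_shift del: sum.lessThan_Suc)
  finally have "2 * (\<Sum>i<n. f i) = (\<Sum>i<n. f (xs ! i) + f (xs ! (Suc i mod n)))"
    by (simp add: sum.distrib reidx)
  also have "\<dots> \<le> (\<Sum>i<n. dist (P (xs ! i)) (P (xs ! (Suc i mod n))))"
    by (intro sum_mono E edge) auto
  also have "\<dots> = tour_length n P s"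
    unfolding tour_length_def by (intro sum.cong) (auto simp: s_def)
  also have "\<dots> \<le> MTSP n P" by (rule tour_length_le_MTSP[OF perm])
  finally show ?thesis .
qed

text \<open>The \<open>m\<close> lightest elements have at most the average weight of
  \<open>A\<close>. They are reached by repeatedly deleting a heaviest element, which never raises
  the average; the inequality is stated without division.\<close>

lemma light_subset:
  fixes \<rho> :: "'a \<Rightarrow> real"
  assumes "finite A" "m \<le> card A" "\<And>a. a \<in> A \<Longrightarrow> 0 \<le> \<rho> a"
  shows "\<exists>Z\<subseteq>A. card Z = m \<and> real (card A) * sum \<rho> Z \<le> real m * sum \<rho> A"
  using assms
proof (induction "card A - m" arbitrary: A)
  case 0
  then show ?case by (intro exI[of _ A]) auto
next
  case (Suc k)
  show ?case
  proof (cases "m = 0")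
    case True
    then show ?thesis by (intro exI[of _ "{}"]) auto
  next
    case False
    have ne: "A \<noteq> {}" using Suc by auto
    have "Max (\<rho> ` A) \<in> \<rho> ` A" using ne Suc.prems(1) by (intro Max_in) auto
    then obtain a where "a \<in> A" "Max (\<rho> ` A) = \<rho> a" by blast
    then have a: "a \<in> A" "\<And>b. b \<in> A \<Longrightarrow> \<rho> b \<le> \<rho> a"
      using Suc.prems(1) by (auto simp flip: \<open>Max (\<rho> ` A) = \<rho> a\<close>)
    define B where "B = A - {a}"
    have cB: "card A = Suc (card B)" and fB: "finite B"
      unfolding B_def using card.remove[OF Suc.prems(1) a(1)] Suc.prems(1) by simp_all
    have "k = card B - m" "m \<le> card B" using Suc cB by auto
    then have "\<exists>Z\<subseteq>B. card Z = m \<and> real (card B) * sum \<rho> Z \<le> real m * sum \<rho> B"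
      using Suc.hyps(1)[of B] fB Suc.prems(3) B_def by auto
    then obtain Z where Z: "Z \<subseteq> B" "card Z = m" "real (card B) * sum \<rho> Z \<le> real m * sum \<rho> B"
      by blast
    have sA: "sum \<rho> A = \<rho> a + sum \<rho> B" unfolding B_def using sum.remove[OF Suc.prems(1) a(1)] .
    have "sum \<rho> B \<le> real (card B) * \<rho> a" using a by (intro sum_bounded_above) (auto simp: B_def)
    then have "real (card A) * sum \<rho> B \<le> real (card B) * sum \<rho> A"
      by (simp add: cB sA algebra_simps)
    then have "real m * (real (card A) * sum \<rho> B) \<le> real m * (real (card B) * sum \<rho> A)"
      by (rule mult_left_mono) simp
    moreover have "real (card A) * (real (card B) * sum \<rho> Z) \<le> real (card A) * (real m * sum \<rho> B)"
      using Z(3) by (rule mult_left_mono) simp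
    ultimately have "real (card B) * (real (card A) * sum \<rho> Z) \<le> real (card B) * (real m * sum \<rho> A)"
      by (simp add: mult_ac)
    moreover have "card B > 0" using \<open>m \<le> card B\<close> False by simp
    ultimately have "real (card A) * sum \<rho> Z \<le> real m * sum \<rho> A" by simp
    then show ?thesis using Z by (intro exI[of _ Z]) (auto simp: B_def)
  qed
qed

lemma MTSP_ge_of_opposite_sectors:
  fixes P :: "nat \<Rightarrow> real^2"
  defines "opp \<equiv> \<lambda>c A B. \<forall>a\<in>A. \<forall>b\<in>B. sqrt 3 / 2 * (dist c (P a) + dist c (P b)) \<le> dist (P a) (P b)"
  assumes sub: "A \<union> A' \<union> B \<union> B' \<union> C \<union> C' \<subseteq> {..<n}"
    and disj: "A \<inter> A' = {}" "B \<inter> B' = {}" "C \<inter> C' = {}" "(A \<union> A') \<inter> (B \<union> B') = {}"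
      "(A \<union> A' \<union> B \<union> B') \<inter> (C \<union> C') = {}"
    and rest: "card ({..<n} - (A \<union> A' \<union> B \<union> B' \<union> C \<union> C')) \<le> 6"
    and bal: "card A \<le> card A' + 6" "card A' \<le> card A + 6" "card B \<le> card B' + 6"
      "card B' \<le> card B + 6" "card C \<le> card C' + 6" "card C' \<le> card C + 6"
    and opp: "opp c A A'" "opp c B B'" "opp c C C'"
    and big: "N \<le> card A" "N \<le> card A'" "14 \<le> N"
  shows "(sqrt 3 - 56 / real N) * (\<Sum>i<n. dist c (P i)) \<le> MTSP n P"
proof -
  let ?\<rho> = "\<lambda>i. dist c (P i)"
  let ?S = "\<Sum>i<n. ?\<rho> i"
  have fin: "finite A" "finite A'" "finite B" "finite B'" "finite C" "finite C'"
    using sub by (auto intro: finite_subset[of _ "{..<n}"])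
  \<comment> \<open>Each of the three sector pairs needs at most \<open>6 + 1\<close> paths and the
    remaining points at most 6, in total 27; twice 14 points give 28 hubs. Taking equally many from
    \<open>A\<close> and \<open>A'\<close> preserves their balance.\<close>
  obtain Z1 where Z1: "Z1 \<subseteq> A" "card Z1 = 14" "real (card A) * sum ?\<rho> Z1 \<le> 14 * sum ?\<rho> A"
    using light_subset[of A 14 ?\<rho>] fin big by auto
  obtain Z2 where Z2: "Z2 \<subseteq> A'" "card Z2 = 14" "real (card A') * sum ?\<rho> Z2 \<le> 14 * sum ?\<rho> A'"
    using light_subset[of A' 14 ?\<rho>] fin big by auto
  define Z where "Z = Z1 \<union> Z2"
  have finZ: "finite Z1" "finite Z2" using Z1 Z2 fin finite_subset by blast+
  have cardZ: "card Z = 28"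
    unfolding Z_def using Z1 Z2 disj finZ by (subst card_Un_disjoint) auto
  have "real N * sum ?\<rho> Z1 \<le> real (card A) * sum ?\<rho> Z1"
    using big by (intro mult_right_mono sum_nonneg) auto
  moreover have "real N * sum ?\<rho> Z2 \<le> real (card A') * sum ?\<rho> Z2"
    using big by (intro mult_right_mono sum_nonneg) auto
  moreover have "sum ?\<rho> Z = sum ?\<rho> Z1 + sum ?\<rho> Z2"
    unfolding Z_def using Z1 Z2 disj finZ by (intro sum.union_disjoint) auto
  moreover have "sum ?\<rho> A + sum ?\<rho> A' = sum ?\<rho> (A \<union> A')"
    using fin disj by (intro sum.union_disjoint[symmetric]) auto
  moreover have "sum ?\<rho> (A \<union> A') \<le> ?S"
    using sub by (intro sum_mono2) auto
  ultimately have "real N * sum ?\<rho> Z \<le> 14 * ?S"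
    using Z1(3) Z2(3) by (simp add: distrib_left)
  then have Zsmall: "sum ?\<rho> Z \<le> 14 / real N * ?S"
    using big by (simp add: field_simps)
  \<comment> \<open>The penalty on \<open>Z\<close> makes every edge at a point of \<open>Z\<close> admissible in \<open>E\<close>, while edges between
    opposite sectors are admissible without it; a Hamiltonian cycle in \<open>E\<close> has length at least
    \<open>2 * sum f\<close>.\<close>
  define f where "f i = sqrt 3 / 2 * ?\<rho> i - (if i \<in> Z then 2 * ?\<rho> i else 0)" for i
  define E where "E i j \<longleftrightarrow> f i + f j \<le> dist (P i) (P j)" for i j
  have sqrt3: "sqrt 3 \<le> 2" by (rule real_le_lsqrt) auto
  have f_le: "f i \<le> ?\<rho> i" "i \<in> Z \<Longrightarrow> f i \<le> - ?\<rho> i" for i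
    using mult_right_mono[OF sqrt3, of "?\<rho> i"] zero_le_dist[of c "P i"] unfolding f_def by (auto simp del: zero_le_dist)
  \<comment> \<open>On \<open>Z\<close> the value of \<open>f\<close> is at most minus the distance
    to \<open>c\<close>, and everywhere it is at most that distance, so the triangle inequality
    suffices.\<close>
  have EZ: "E z v \<and> E v z" if "z \<in> Z" for z v
  proof -
    have "?\<rho> v \<le> ?\<rho> z + dist (P z) (P v)" by (rule dist_triangle)
    then show ?thesis
      using f_le(2)[OF that] f_le(1)[of v] by (simp add: E_def dist_commute)
  qed
  have f_half: "f i \<le> sqrt 3 / 2 * ?\<rho> i" for i by (simp add: f_def)
  have Eopp: "E a b \<and> E b a" if "opp c X Y" "a \<in> X" "b \<in> Y" for X Y a b
  proof -
    have "sqrt 3 / 2 * (?\<rho> a + ?\<rho> b) \<le> dist (P a) (P b)" using that unfolding opp_def by blast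
    then show ?thesis
      using f_half[of a] f_half[of b] by (simp add: E_def dist_commute distrib_left)
  qed
  have pA: "path_cover E ((A - Z1) \<union> (A' - Z2)) (6 + 1)"
    using Z1 Z2 finZ fin disj bal Eopp[OF opp(1)]
    by (intro path_cover_bipartite) (auto simp: card_Diff_subset)
  have pB: "path_cover E (B \<union> B') (6 + 1)"
    using fin disj bal Eopp[OF opp(2)] by (intro path_cover_bipartite) auto
  have pC: "path_cover E (C \<union> C') (6 + 1)"
    using fin disj bal Eopp[OF opp(3)] by (intro path_cover_bipartite) auto
  have pR: "path_cover E ({..<n} - (A \<union> A' \<union> B \<union> B' \<union> C \<union> C')) 6"
    using path_cover_mono[OF path_cover_card rest] by blast
  have "path_cover E (((A - Z1) \<union> (A' - Z2)) \<union> (B \<union> B') \<union> (C \<union> C') \<union>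
      ({..<n} - (A \<union> A' \<union> B \<union> B' \<union> C \<union> C'))) ((6 + 1) + (6 + 1) + (6 + 1) + 6)"
    by (rule path_cover_Un[OF path_cover_Un[OF path_cover_Un[OF pA pB] pC] pR]) (use disj in auto)
  moreover have "((A - Z1) \<union> (A' - Z2)) \<union> (B \<union> B') \<union> (C \<union> C') \<union>
      ({..<n} - (A \<union> A' \<union> B \<union> B' \<union> C \<union> C')) = {..<n} - Z"
    using sub disj Z1 Z2 unfolding Z_def by auto
  ultimately have "path_cover E ({..<n} - Z) ((6 + 1) + (6 + 1) + (6 + 1) + 6)" by simp
  then have "path_cover E ({..<n} - Z) (card Z)"
    by (rule path_cover_mono) (simp add: cardZ)
  then have "\<exists>xs. distinct xs \<and> set xs = {..<n} \<and> xs \<noteq> [] \<and> successively E xs \<and> E (last xs) (hd xs)"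
    by (rule hamiltonian_of_path_cover) (use cardZ finZ EZ Z1(1,2) Z2(1) sub in \<open>auto simp: Z_def\<close>)
  then obtain xs where "distinct xs" "set xs = {..<n}" "xs \<noteq> []" "successively E xs" "E (last xs) (hd xs)"
    by blast
  then have "2 * (\<Sum>i<n. f i) \<le> MTSP n P"
    by (rule MTSP_ge_of_hamiltonian) (simp add: E_def)
  \<comment> \<open>The penalty of twice the distance is counted twice, so the loss is at most
    \<open>4 * 14 / N = 56 / N\<close> times the star.\<close>
  moreover have "2 * (\<Sum>i<n. f i) = sqrt 3 * ?S - 4 * sum ?\<rho> Z"
  proof -
    have "Z \<subseteq> {..<n}" using Z1 Z2 sub unfolding Z_def by auto
    then have "(\<Sum>i<n. if i \<in> Z then 2 * ?\<rho> i else 0) = (\<Sum>i\<in>Z. 2 * ?\<rho> i)"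
      by (simp add: Int_absorb1 flip: sum.inter_restrict)
    then show ?thesis
      by (simp add: f_def sum_subtractf sum_distrib_left)
  qed
  ultimately show ?thesis using Zsmall by (simp add: algebra_simps)
qed

section \<open>The upper bound\<close>

definition cross2 :: "real^2 \<Rightarrow> real^2 \<Rightarrow> real" where
  "cross2 x y = x $ 1 * y $ 2 - x $ 2 * y $ 1"

text \<open>The condition is on indices, so for \<open>n >= 3\<close> it also excludes repeated
  points.\<close>

definition no_three_collinear :: "nat \<Rightarrow> (nat \<Rightarrow> real^2) \<Rightarrow> bool" where
  "no_three_collinear n P \<longleftrightarrow> (\<forall>i<n. \<forall>j<n. \<forall>k<n. i \<noteq> j \<longrightarrow> i \<noteq> k \<longrightarrow> j \<noteq> k \<longrightarrow>
     cross2 (P j - P i) (P k - P i) \<noteq> 0)"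

text \<open>For three points on the line, two difference vectors are both orthogonal to
  \<open>dir t\<close>, hence parallel, and their cross product vanishes.\<close>

lemma card_on_line:
  assumes "no_three_collinear n P"
  shows "card {i. i < n \<and> (P i - c) \<bullet> dir t = 0} \<le> 2"
proof (rule ccontr)
  let ?L = "{i. i < n \<and> (P i - c) \<bullet> dir t = 0}"
  assume "\<not> ?thesis"
  then have "3 \<le> card ?L" by simp
  then obtain T where "T \<subseteq> ?L" "card T = 3"
    using obtain_subset_with_card_n[of 3 ?L] by metis
  then obtain i j k where ijk: "{i, j, k} \<subseteq> ?L" "i \<noteq> j" "i \<noteq> k" "j \<noteq> k"
    by (auto simp: card_3_iff)
  define u v where "u = P j - P i" and "v = P k - P i"
  have "u \<bullet> dir t = (P j - c) \<bullet> dir t - (P i - c) \<bullet> dir t"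
    "v \<bullet> dir t = (P k - c) \<bullet> dir t - (P i - c) \<bullet> dir t"
    by (simp_all add: u_def v_def inner_diff_left)
  then have uv: "u $ 1 * cos t + u $ 2 * sin t = 0" "v $ 1 * cos t + v $ 2 * sin t = 0"
    using ijk by (simp_all add: inner_dir)
  have "cross2 u v * cos t = 0" "cross2 u v * sin t = 0"
    unfolding cross2_def using uv by algebra+
  moreover have "cos t \<noteq> 0 \<or> sin t \<noteq> 0" using sin_zero_abs_cos_one by fastforce
  ultimately have "cross2 u v = 0" by auto
  then show False
    using assms ijk unfolding no_three_collinear_def u_def v_def by auto
qed

text \<open>Projecting \<open>x - y\<close> onto the common axis \<open>w\<close> adds up the two
  one-sided projections.\<close>

lemma norm_diff_opposite:
  assumes "norm w = 1" "k * norm x \<le> x \<bullet> w" "k * norm y \<le> - (y \<bullet> w)"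
  shows "k * (norm x + norm y) \<le> norm (x - y)"
proof -
  have "(x - y) \<bullet> w \<le> norm (x - y)" using norm_cauchy_schwarz[of "x - y" w] assms(1) by simp
  then show ?thesis using assms by (simp add: inner_diff_left distrib_left)
qed

lemma sqrt3_half_le:
  assumes "3/4 * N\<^sup>2 \<le> w\<^sup>2" "0 \<le> w"
  shows "sqrt 3 / 2 * N \<le> w"
proof (rule power2_le_imp_le[OF _ assms(2)])
  have "(sqrt 3 / 2 * N)\<^sup>2 = 3/4 * N\<^sup>2" by (simp add: power_mult_distrib power_divide)
  then show "(sqrt 3 / 2 * N)\<^sup>2 \<le> w\<^sup>2" using assms(1) by simp
qed

text \<open>Within a 60 degree sector a vector deviates from the sector's axis by at most 30
  degrees, and cos 30 is \<open>sqrt 3 / 2\<close>. Algebraically, \<open>norm_via_dirs\<close>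
  writes 3/4 of the squared norm as \<open>(s + u)^2 - s * u\<close>, as
  \<open>s^2 + u * (s + u)\<close> and as \<open>u^2 + s * (s + u)\<close>; the sector fixes the
  sign of the extra term.\<close>

lemma sector_axis:
  fixes x :: "real^2" and t :: real
  defines "s \<equiv> x \<bullet> dir t" and "u \<equiv> x \<bullet> dir (t + 2*pi/3)"
  shows "0 \<le> s \<Longrightarrow> 0 \<le> u \<Longrightarrow> sqrt 3 / 2 * norm x \<le> s + u"
    and "u \<le> 0 \<Longrightarrow> 0 \<le> s + u \<Longrightarrow> sqrt 3 / 2 * norm x \<le> s"
    and "0 \<le> s \<Longrightarrow> s + u \<le> 0 \<Longrightarrow> sqrt 3 / 2 * norm x \<le> - u"
proof -
  have N: "3/4 * (norm x)\<^sup>2 = s\<^sup>2 + s * u + u\<^sup>2" unfolding s_def u_def by (rule norm_via_dirs)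
  show "sqrt 3 / 2 * norm x \<le> s + u" if "0 \<le> s" "0 \<le> u"
  proof (rule sqrt3_half_le)
    have "0 \<le> s * u" using that by simp
    then show "3/4 * (norm x)\<^sup>2 \<le> (s + u)\<^sup>2" unfolding N by (simp add: power2_sum)
  qed (use that in simp)
  show "sqrt 3 / 2 * norm x \<le> s" if "u \<le> 0" "0 \<le> s + u"
  proof (rule sqrt3_half_le)
    have "u * (s + u) \<le> 0" using that by (simp add: mult_nonpos_nonneg)
    then show "3/4 * (norm x)\<^sup>2 \<le> s\<^sup>2" unfolding N by (simp add: power2_eq_square algebra_simps)
  qed (use that in simp)
  show "sqrt 3 / 2 * norm x \<le> - u" if "0 \<le> s" "s + u \<le> 0"
  proof (rule sqrt3_half_le)
    have "s * (s + u) \<le> 0" using that by (simp add: mult_nonneg_nonpos)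
    then show "3/4 * (norm x)\<^sup>2 \<le> (- u)\<^sup>2" unfolding N by (simp add: power2_eq_square algebra_simps)
  qed (use that in simp)
qed

lemma card_disjoint3_le:
  assumes "finite U" "X \<union> Y \<union> W \<subseteq> U" "X \<inter> Y = {}" "(X \<union> Y) \<inter> W = {}"
  shows "card X + card Y + card W \<le> card U"
proof -
  have fin: "finite X" "finite Y" "finite W" using assms finite_subset by auto
  then have "card X + card Y + card W = card (X \<union> Y \<union> W)"
    using assms by (simp add: card_Un_disjoint)
  also have "\<dots> \<le> card U" using assms by (intro card_mono) auto
  finally show ?thesis .
qed

lemma FWP_le: "FWP n P \<le> (\<Sum>i<n. dist c (P i))"
  unfolding FWP_def
  by (rule cINF_lower) (auto intro!: bdd_belowI[of _ 0] sum_nonneg)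

lemma FWP_ge: "(\<And>c. x \<le> (\<Sum>i<n. dist c (P i))) \<Longrightarrow> x \<le> FWP n P"
  unfolding FWP_def by (rule cINF_greatest) auto

text \<open>The threshold is 360 = 336 + 24, where the error term equals 1; beyond it the factor in
  front of \<open>FWP\<close> stays positive.\<close>

lemma error_term_less_sqrt3:
  assumes "n \<ge> 360"
  shows "336 / (real n - 24) < sqrt 3"
proof -
  have "336 / (real n - 24) \<le> 1" using assms by (simp add: field_simps)
  also have "1 < sqrt 3" by simp
  finally show ?thesis .
qed

lemma FWP_le_MTSP_no_three_collinear:
  assumes n: "n \<ge> 360" and gp: "no_three_collinear n P"
  shows "(sqrt 3 - 336 / (real n - 24)) * FWP n P \<le> MTSP n P"
proof -
  let ?\<kappa> = "sqrt 3 - 336 / (real n - 24)"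
  have "n > 0" using n by simp
  obtain t c where
    pos: "\<And>s. s \<in> {t, t + pi/3, t + 2*pi/3} \<Longrightarrow> 2 * card {i. i < n \<and> (P i - c) \<bullet> dir s > 0} \<le> n" and
    neg: "\<And>s. s \<in> {t, t + pi/3, t + 2*pi/3} \<Longrightarrow> 2 * card {i. i < n \<and> (P i - c) \<bullet> dir s < 0} \<le> n"
    using concurrent_medians[OF \<open>n > 0\<close>, of P] by blast
  define s where "s i = (P i - c) \<bullet> dir t" for i
  define u where "u i = (P i - c) \<bullet> dir (t + 2*pi/3)" for i
  have mid: "(P i - c) \<bullet> dir (t + pi/3) = s i + u i" for i
    unfolding s_def u_def by (simp only: dir_add_third[symmetric] inner_add_right)
  \<comment> \<open>The six open sectors in opposite pairs. \<open>A\<close>, \<open>B\<close> and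
    \<open>C'\<close> have the axes \<open>dir (t + pi/3)\<close>, \<open>dir t\<close> and
    \<open>dir (t + 2*pi/3)\<close>; their partners have the negated axes.\<close>
  define A A' B B' C C' where
    "A = {i. i < n \<and> s i > 0 \<and> u i > 0}" and "A' = {i. i < n \<and> s i < 0 \<and> u i < 0}" and
    "B = {i. i < n \<and> u i < 0 \<and> s i + u i > 0}" and "B' = {i. i < n \<and> u i > 0 \<and> s i + u i < 0}" and
    "C = {i. i < n \<and> s i > 0 \<and> s i + u i < 0}" and "C' = {i. i < n \<and> s i < 0 \<and> s i + u i > 0}"
  note sets = A_def A'_def B_def B'_def C_def C'_def
  have disj: "A \<inter> A' = {}" "A \<inter> B = {}" "A \<inter> B' = {}" "A \<inter> C = {}" "A \<inter> C' = {}"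
    "A' \<inter> B = {}" "A' \<inter> B' = {}" "A' \<inter> C = {}" "A' \<inter> C' = {}" "B \<inter> B' = {}" "B \<inter> C = {}"
    "B \<inter> C' = {}" "B' \<inter> C = {}" "B' \<inter> C' = {}" "C \<inter> C' = {}"
    unfolding sets by auto
  have sub: "A \<subseteq> {..<n}" "A' \<subseteq> {..<n}" "B \<subseteq> {..<n}" "B' \<subseteq> {..<n}" "C \<subseteq> {..<n}" "C' \<subseteq> {..<n}"
    unfolding sets by auto
  have fin: "finite A" "finite A'" "finite B" "finite B'" "finite C" "finite C'"
    unfolding sets by auto
  define R where "R = {..<n} - (A \<union> A' \<union> B \<union> B' \<union> C \<union> C')"
  \<comment> \<open>Points outside all open sectors lie on one of the three lines, each of which
    carries at most two points.\<close>
  have "R \<subseteq> {i. i < n \<and> s i = 0} \<union> {i. i < n \<and> s i + u i = 0} \<union> {i. i < n \<and> u i = 0}"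
    unfolding R_def sets by force
  then have "card R \<le> card ({i. i < n \<and> s i = 0} \<union> {i. i < n \<and> s i + u i = 0} \<union> {i. i < n \<and> u i = 0})"
    by (intro card_mono) auto
  also have "\<dots> \<le> card {i. i < n \<and> s i = 0} + card {i. i < n \<and> s i + u i = 0} + card {i. i < n \<and> u i = 0}"
    by (meson add_le_mono1 card_Un_le le_trans)
  also have "\<dots> \<le> 2 + 2 + 2"
    using card_on_line[OF gp, of c t] card_on_line[OF gp, of c "t + pi/3"]
      card_on_line[OF gp, of c "t + 2*pi/3"]
    unfolding mid s_def[symmetric] u_def[symmetric] by (intro add_mono)
  finally have R: "card R \<le> 6" by simp
  have "{..<n} = R \<union> ((A \<union> A') \<union> (B \<union> B') \<union> (C \<union> C'))" unfolding R_def using sub by auto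
  then have "card {..<n} \<le> card R + card ((A \<union> A') \<union> (B \<union> B') \<union> (C \<union> C'))"
    using card_Un_le by metis
  also have "card ((A \<union> A') \<union> (B \<union> B') \<union> (C \<union> C')) =
      card A + card A' + card B + card B' + card C + card C'"
    using fin disj by (simp add: card_Un_disjoint Int_Un_distrib Int_Un_distrib2)
  finally have total: "n \<le> 6 + (card A + card A' + card B + card B' + card C + card C')"
    using R by simp
  \<comment> \<open>Each open side of a median line contains three consecutive sectors.\<close>
  have half:
    "2 * (card A + card B + card C) \<le> n" "2 * (card A' + card B' + card C') \<le> n"
    "2 * (card A + card B + card C') \<le> n" "2 * (card A' + card B' + card C) \<le> n"
    "2 * (card A + card B' + card C') \<le> n" "2 * (card A' + card B + card C) \<le> n"
  proof -
    have "card A + card B + card C \<le> card {i. i < n \<and> s i > 0}"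
      by (intro card_disjoint3_le) (auto simp: sets)
    then show "2 * (card A + card B + card C) \<le> n"
      using pos[of t] unfolding s_def[symmetric] by simp
    have "card A' + card B' + card C' \<le> card {i. i < n \<and> s i < 0}"
      by (intro card_disjoint3_le) (auto simp: sets)
    then show "2 * (card A' + card B' + card C') \<le> n"
      using neg[of t] unfolding s_def[symmetric] by simp
    have "card A + card B + card C' \<le> card {i. i < n \<and> s i + u i > 0}"
      by (intro card_disjoint3_le) (auto simp: sets)
    then show "2 * (card A + card B + card C') \<le> n"
      using pos[of "t + pi/3"] unfolding mid by simp
    have "card A' + card B' + card C \<le> card {i. i < n \<and> s i + u i < 0}"
      by (intro card_disjoint3_le) (auto simp: sets)
    then show "2 * (card A' + card B' + card C) \<le> n"
      using neg[of "t + pi/3"] unfolding mid by simp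
    have "card A + card B' + card C' \<le> card {i. i < n \<and> u i > 0}"
      by (intro card_disjoint3_le) (auto simp: sets)
    then show "2 * (card A + card B' + card C') \<le> n"
      using pos[of "t + 2*pi/3"] unfolding u_def[symmetric] by simp
    have "card A' + card B + card C \<le> card {i. i < n \<and> u i < 0}"
      by (intro card_disjoint3_le) (auto simp: sets)
    then show "2 * (card A' + card B + card C) \<le> n"
      using neg[of "t + 2*pi/3"] unfolding u_def[symmetric] by simp
  qed
  \<comment> \<open>For each sector there are two of these half-planes that share only it and
    together miss only its opposite. Adding their bounds and comparing with \<open>total\<close>
    leaves an excess of at most 6.\<close>
  have bal: "card A \<le> card A' + 6" "card A' \<le> card A + 6" "card B \<le> card B' + 6"
    "card B' \<le> card B + 6" "card C \<le> card C' + 6" "card C' \<le> card C + 6"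
    using total half by simp_all
  let ?opp = "\<lambda>X Y. \<forall>a\<in>X. \<forall>b\<in>Y. sqrt 3 / 2 * (dist c (P a) + dist c (P b)) \<le> dist (P a) (P b)"
  have oppI: "?opp X Y"
    if "norm w = 1" "\<And>i. i \<in> X \<Longrightarrow> sqrt 3 / 2 * norm (P i - c) \<le> (P i - c) \<bullet> w"
      "\<And>i. i \<in> Y \<Longrightarrow> sqrt 3 / 2 * norm (P i - c) \<le> - ((P i - c) \<bullet> w)" for X Y w
  proof (intro ballI)
    fix a b assume "a \<in> X" "b \<in> Y"
    then show "sqrt 3 / 2 * (dist c (P a) + dist c (P b)) \<le> dist (P a) (P b)"
      using norm_diff_opposite[OF that(1) that(2) that(3), of a b]
      by (simp add: dist_norm norm_minus_commute)
  qed
  have axis: "0 \<le> s i \<Longrightarrow> 0 \<le> u i \<Longrightarrow> sqrt 3 / 2 * norm (P i - c) \<le> s i + u i"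
    "u i \<le> 0 \<Longrightarrow> 0 \<le> s i + u i \<Longrightarrow> sqrt 3 / 2 * norm (P i - c) \<le> s i"
    "0 \<le> s i \<Longrightarrow> s i + u i \<le> 0 \<Longrightarrow> sqrt 3 / 2 * norm (P i - c) \<le> - u i" for i
    using sector_axis[of "P i - c" t] unfolding s_def u_def by blast+
  \<comment> \<open>The opposite sectors, by reflection in \<open>c\<close>.\<close>
  have axis': "s i \<le> 0 \<Longrightarrow> u i \<le> 0 \<Longrightarrow> sqrt 3 / 2 * norm (P i - c) \<le> - (s i + u i)"
    "0 \<le> u i \<Longrightarrow> s i + u i \<le> 0 \<Longrightarrow> sqrt 3 / 2 * norm (P i - c) \<le> - s i"
    "s i \<le> 0 \<Longrightarrow> 0 \<le> s i + u i \<Longrightarrow> sqrt 3 / 2 * norm (P i - c) \<le> u i" for i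
    using sector_axis[of "- (P i - c)" t] unfolding s_def u_def inner_minus_left norm_minus_cancel
    by linarith+
  have opp: "?opp A A'" "?opp B B'" "?opp C' C"
  proof -
    show "?opp A A'"
      by (rule oppI[of "dir (t + pi/3)"]) (use axis axis' in \<open>auto simp: norm_dir mid sets\<close>)
    show "?opp B B'"
      by (rule oppI[of "dir t"]) (use axis axis' in \<open>auto simp: norm_dir sets simp flip: s_def\<close>)
    show "?opp C' C"
      by (rule oppI[of "dir (t + 2*pi/3)"]) (use axis axis' in \<open>auto simp: norm_dir sets simp flip: u_def\<close>)
  qed
  let ?S = "\<Sum>i<n. dist c (P i)"
  have S0: "0 \<le> ?S" by (intro sum_nonneg) auto
  \<comment> \<open>From \<open>N >= (n - 24) / 6\<close> the loss \<open>56 / N\<close> is at most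
    \<open>336 / (n - 24)\<close>.\<close>
  have weaken: "?\<kappa> * ?S \<le> MTSP n P"
    if "n \<le> 6 * N + 24" "(sqrt 3 - 56 / real N) * ?S \<le> MTSP n P" for N
  proof -
    have "real n - 24 \<le> 6 * real N" using that(1) by linarith
    then have "56 / real N \<le> 336 / (real n - 24)" using n by (simp add: field_simps)
    then have "?\<kappa> * ?S \<le> (sqrt 3 - 56 / real N) * ?S" using S0 by (intro mult_right_mono) auto
    with that(2) show ?thesis by simp
  qed
  have R': "R = {..<n} - (B \<union> B' \<union> A \<union> A' \<union> C' \<union> C)" "R = {..<n} - (C' \<union> C \<union> A \<union> A' \<union> B \<union> B')"
    "R = {..<n} - (A \<union> A' \<union> B \<union> B' \<union> C' \<union> C)"
    unfolding R_def by (simp_all only: Un_ac)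
  have "?\<kappa> * ?S \<le> MTSP n P"
  proof -
    \<comment> \<open>A pair with at least \<open>(n - 6) / 3\<close> points, balanced up to 6, has
      at least \<open>(n - 24) / 6\<close> points in each sector; for \<open>n >= 360\<close> this
      exceeds the 14 hubs wanted.\<close>
    have min_ge: "n \<le> 6 * min p q + 24" "14 \<le> min p q" if "n \<le> 3 * (p + q) + 6" "p \<le> q + 6" "q \<le> p + 6" for p q
      using that n by (simp_all add: min_def)
    \<comment> \<open>Pigeonhole over the three pairs. The chosen pair takes the first two places in
      \<open>MTSP_ge_of_opposite_sectors\<close>, since it supplies the hubs.\<close>
    have "n \<le> 3 * (card A + card A') + 6 \<or> n \<le> 3 * (card B + card B') + 6 \<or>
        n \<le> 3 * (card C' + card C) + 6"
      using total by arith
    then consider "n \<le> 3 * (card A + card A') + 6" | "n \<le> 3 * (card B + card B') + 6"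
      | "n \<le> 3 * (card C' + card C) + 6"
      by blast
    then show ?thesis
    proof cases
      case 1
      note 1 = min_ge[OF 1 bal(1,2)]
      show ?thesis
        by (rule weaken[OF 1(1)], rule MTSP_ge_of_opposite_sectors[of A A' B B' C' C])
          (rule bal opp R[unfolded R'(3)] min.cobounded1 min.cobounded2 1(2)
            | simp add: sub disj disj[THEN trans[OF Int_commute]] Int_Un_distrib Int_Un_distrib2)+
    next
      case 2
      note 2 = min_ge[OF 2 bal(3,4)]
      show ?thesis
        by (rule weaken[OF 2(1)], rule MTSP_ge_of_opposite_sectors[of B B' A A' C' C])
          (rule bal opp R[unfolded R'(1)] min.cobounded1 min.cobounded2 2(2)
            | simp add: sub disj disj[THEN trans[OF Int_commute]] Int_Un_distrib Int_Un_distrib2)+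
    next
      case 3
      note 3 = min_ge[OF 3 bal(6,5)]
      show ?thesis
        by (rule weaken[OF 3(1)], rule MTSP_ge_of_opposite_sectors[of C' C A A' B B'])
          (rule bal opp R[unfolded R'(2)] min.cobounded1 min.cobounded2 3(2)
            | simp add: sub disj disj[THEN trans[OF Int_commute]] Int_Un_distrib Int_Un_distrib2)+
    qed
  qed
  moreover have "?\<kappa> * FWP n P \<le> ?\<kappa> * ?S"
    using error_term_less_sqrt3[OF n] by (intro mult_left_mono FWP_le) simp
  ultimately show ?thesis by linarith
qed

section \<open>Perturbation into general position\<close>

lemma FWP_perturb:
  assumes "\<And>i. i < n \<Longrightarrow> dist (P i) (Q i) \<le> d"
  shows "FWP n P - real n * d \<le> FWP n Q"
proof (rule FWP_ge)
  fix c
  have "FWP n P \<le> (\<Sum>i<n. dist c (P i))" by (rule FWP_le)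
  also have "\<dots> \<le> (\<Sum>i<n. dist c (Q i) + d)"
  proof (rule sum_mono)
    fix i assume "i \<in> {..<n}"
    then show "dist c (P i) \<le> dist c (Q i) + d"
      using assms[of i] dist_triangle[of c "P i" "Q i"] by (simp add: dist_commute)
  qed
  finally show "FWP n P - real n * d \<le> (\<Sum>i<n. dist c (Q i))" by (simp add: sum.distrib)
qed

lemma MTSP_leI:
  assumes "\<And>s. s permutes {..<n} \<Longrightarrow> tour_length n P s \<le> x"
  shows "MTSP n P \<le> x"
proof -
  have "id permutes {..<n}" by (rule permutes_id)
  then show ?thesis
    unfolding MTSP_def using assms by (subst Max_le_iff[OF finite_tours]) blast+
qed

lemma MTSP_perturb:
  assumes "\<And>i. i < n \<Longrightarrow> dist (P i) (Q i) \<le> d"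
  shows "MTSP n Q \<le> MTSP n P + 2 * real n * d"
proof (rule MTSP_leI)
  fix s assume s: "s permutes {..<n}"
  have "tour_length n Q s \<le> (\<Sum>i<n. dist (P (s i)) (P (s (Suc i mod n))) + 2 * d)"
    unfolding tour_length_def
  proof (rule sum_mono)
    fix i assume i: "i \<in> {..<n}"
    then have "s i < n" "s (Suc i mod n) < n"
      using permutes_in_image[OF s] by (metis lessThan_iff, metis lessThan_iff mod_less_divisor not_less_zero gr0I)
    then have "dist (P (s i)) (Q (s i)) \<le> d" "dist (P (s (Suc i mod n))) (Q (s (Suc i mod n))) \<le> d"
      using assms by auto
    then show "dist (Q (s i)) (Q (s (Suc i mod n))) \<le> dist (P (s i)) (P (s (Suc i mod n))) + 2 * d"
      by metric
  qed
  also have "\<dots> = tour_length n P s + 2 * real n * d"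
    by (simp add: tour_length_def sum.distrib)
  finally show "tour_length n Q s \<le> MTSP n P + 2 * real n * d"
    using tour_length_le_MTSP[OF s, of P] by linarith
qed

text \<open>For three distinct indices the cross product is a quadratic polynomial in
  \<open>e\<close>. Its leading coefficient is the Vandermonde product \<open>V\<close> of three
  points on the parabola, hence nonzero, so only finitely many \<open>e\<close> are bad.\<close>

lemma eventually_no_three_collinear:
  defines "w \<equiv> \<lambda>i::nat. vector [real i, (real i)\<^sup>2] :: real^2"
  shows "eventually (\<lambda>e. no_three_collinear n (\<lambda>i. P i + e *\<^sub>R w i)) (at_right 0)"
proof -
  have "eventually (\<lambda>e. i \<noteq> j \<longrightarrow> i \<noteq> k \<longrightarrow> j \<noteq> k \<longrightarrow>
      cross2 (P j + e *\<^sub>R w j - (P i + e *\<^sub>R w i)) (P k + e *\<^sub>R w k - (P i + e *\<^sub>R w i)) \<noteq> 0) (at_right 0)"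
    (is "eventually (\<lambda>e. _ \<longrightarrow> _ \<longrightarrow> _ \<longrightarrow> ?cr e \<noteq> 0) _") for i j k
  proof (cases "i \<noteq> j \<and> i \<noteq> k \<and> j \<noteq> k")
    case True
    define p q where "p = P j - P i" and "q = P k - P i"
    define V where "V = (real j - real i) * (real k - real i) * (real k - real j)"
    define \<beta> where "\<beta> = cross2 p (w k - w i) + cross2 (w j - w i) q"
    have "V \<noteq> 0" using True by (simp add: V_def)
    have cr: "?cr e = poly [:cross2 p q, \<beta>, V:] e" for e
      by (simp add: cross2_def p_def q_def V_def \<beta>_def w_def power2_eq_square algebra_simps)
    have "finite {e. poly [:cross2 p q, \<beta>, V:] e = 0}"
      using \<open>V \<noteq> 0\<close> by (intro poly_roots_finite) auto
    then have "eventually (\<lambda>e. \<forall>z\<in>{e. poly [:cross2 p q, \<beta>, V:] e = 0}. e \<noteq> z) (at_right 0)"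
      by (rule eventually_ball_finite) (auto intro: eventually_neq_at_within)
    then show ?thesis
      by (rule eventually_mono) (auto simp: cr)
  qed auto
  then have "eventually (\<lambda>e. \<forall>i\<in>{..<n}. \<forall>j\<in>{..<n}. \<forall>k\<in>{..<n}. i \<noteq> j \<longrightarrow> i \<noteq> k \<longrightarrow> j \<noteq> k \<longrightarrow>
      cross2 (P j + e *\<^sub>R w j - (P i + e *\<^sub>R w i)) (P k + e *\<^sub>R w k - (P i + e *\<^sub>R w i)) \<noteq> 0) (at_right 0)"
    by (intro eventually_ball_finite ballI finite_lessThan)
  then show ?thesis
    by (rule eventually_mono) (auto simp: no_three_collinear_def)
qed

lemma FWP_le_MTSP:
  assumes n: "n \<ge> 360"
  shows "(sqrt 3 - 336 / (real n - 24)) * FWP n P \<le> MTSP n P"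
proof -
  define \<kappa> where "\<kappa> = sqrt 3 - 336 / (real n - 24)"
  have \<kappa>: "0 \<le> \<kappa>" using error_term_less_sqrt3[OF n] by (simp add: \<kappa>_def)
  define w where "w i = (vector [real i, (real i)\<^sup>2] :: real^2)" for i :: nat
  define K where "K = (\<Sum>i<n. norm (w i))"
  \<comment> \<open>The inequality in general position, with both sides corrected by terms linear in
    \<open>e\<close>; letting \<open>e\<close> tend to 0 from the right removes them.\<close>
  have "eventually (\<lambda>e. \<kappa> * (FWP n P - real n * (e * K)) \<le> MTSP n P + 2 * real n * (e * K)) (at_right 0)"
    using eventually_no_three_collinear[of n P, folded w_def] eventually_at_right_less[of 0]
  proof eventually_elim
    case (elim e)
    let ?Q = "\<lambda>i. P i + e *\<^sub>R w i"
    have close: "dist (P i) (?Q i) \<le> e * K" if "i < n" for i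
    proof -
      have "norm (w i) \<le> K" unfolding K_def using that by (intro member_le_sum) auto
      then show ?thesis using elim(2) by (simp add: dist_norm)
    qed
    have "\<kappa> * (FWP n P - real n * (e * K)) \<le> \<kappa> * FWP n ?Q"
      using FWP_perturb[of n P ?Q, OF close] \<kappa> by (intro mult_left_mono) auto
    also have "\<dots> \<le> MTSP n ?Q"
      unfolding \<kappa>_def by (rule FWP_le_MTSP_no_three_collinear[OF n elim(1)])
    also have "\<dots> \<le> MTSP n P + 2 * real n * (e * K)"
      by (rule MTSP_perturb[OF close])
    finally show ?case .
  qed
  moreover have "((\<lambda>e. \<kappa> * (FWP n P - real n * (e * K))) \<longlongrightarrow> \<kappa> * (FWP n P - real n * (0 * K))) (at_right 0)"
    by (intro tendsto_intros)
  moreover have "((\<lambda>e. MTSP n P + 2 * real n * (e * K)) \<longlongrightarrow> MTSP n P + 2 * real n * (0 * K)) (at_right 0)"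
    by (intro tendsto_intros)
  ultimately have "\<kappa> * (FWP n P - real n * (0 * K)) \<le> MTSP n P + 2 * real n * (0 * K)"
    by (intro tendsto_le[of "at_right (0::real)"]) auto
  then show ?thesis by (simp add: \<kappa>_def)
qed

section \<open>The triangle and the limit\<close>

text \<open>The third roots of unity, repeated cyclically: circumradius 1 and side
  \<open>sqrt 3\<close>.\<close>

definition triangle_vertex :: "nat \<Rightarrow> real^2" where
  "triangle_vertex i = (if i mod 3 = 0 then vector [1, 0] else if i mod 3 = 1 then vector [-1/2, sqrt 3 / 2]
     else vector [-1/2, - sqrt 3 / 2])"

lemma norm_real2: "norm (x::real^2) = sqrt ((x $ 1)\<^sup>2 + (x $ 2)\<^sup>2)"
  by (simp add: norm_vec_def L2_set_def sum_2)

lemma norm_triangle: "norm (triangle_vertex i) = 1"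
  by (simp add: norm_real2 triangle_vertex_def power_divide)

lemma dist_triangle_vertices: "dist (triangle_vertex i) (triangle_vertex j) \<le> sqrt 3"
  by (simp add: dist_norm norm_real2 triangle_vertex_def power_divide power_mult_distrib)

text \<open>Projecting onto the unit vector \<open>v\<close> bounds the distance from
  \<open>c\<close> to a vertex \<open>v\<close> below by \<open>1 - c \<bullet> v\<close>. Over a
  full triple the linear terms cancel because the vertices sum to zero.\<close>

lemma triangle_star_ge: "3 * real q \<le> (\<Sum>i<3 * q. dist c (triangle_vertex i))"
proof (induction q)
  case 0
  then show ?case by simp
next
  case (Suc q)
  have one: "1 - c \<bullet> triangle_vertex i \<le> dist c (triangle_vertex i)" for i
    using norm_cauchy_schwarz[of "triangle_vertex i - c" "triangle_vertex i"] norm_triangle[of i]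
    by (simp add: inner_diff_left dist_norm norm_minus_commute flip: power2_norm_eq_inner)
  have "triangle_vertex (3*q) + triangle_vertex (Suc (3*q)) + triangle_vertex (Suc (Suc (3*q))) = 0"
  proof -
    have "Suc (3*q) mod 3 = 1" "Suc (Suc (3*q)) mod 3 = 2" by presburger+
    then show ?thesis by (simp add: triangle_vertex_def vec_eq_iff forall_2)
  qed
  then have "c \<bullet> triangle_vertex (3*q) + c \<bullet> triangle_vertex (Suc (3*q)) + c \<bullet> triangle_vertex (Suc (Suc (3*q))) = 0"
    by (metis inner_add_right inner_zero_right)
  with Suc one[of "3*q"] one[of "Suc (3*q)"] one[of "Suc (Suc (3*q))"]
  show ?case by (simp add: numeral_3_eq_3)
qed

lemma FWP_triangle_ge: "real n - 2 \<le> FWP n triangle_vertex"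
proof (rule FWP_ge)
  fix c
  \<comment> \<open>At most two points are left over after the complete triples.\<close>
  have "real n - 2 \<le> 3 * real (n div 3)" by linarith
  also have "\<dots> \<le> (\<Sum>i<3 * (n div 3). dist c (triangle_vertex i))" by (rule triangle_star_ge)
  also have "\<dots> \<le> (\<Sum>i<n. dist c (triangle_vertex i))" by (intro sum_mono2) auto
  finally show "real n - 2 \<le> (\<Sum>i<n. dist c (triangle_vertex i))" .
qed

lemma MTSP_triangle_le: "MTSP n triangle_vertex \<le> real n * sqrt 3"
proof (rule MTSP_leI)
  fix s
  have "tour_length n triangle_vertex s \<le> (\<Sum>i<n. sqrt 3)"
    unfolding tour_length_def by (intro sum_mono dist_triangle_vertices)
  then show "tour_length n triangle_vertex s \<le> real n * sqrt 3" by simp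
qed

theorem theorem3:
  shows "(\<lambda>n. r n) \<longlonglongrightarrow> 2 / sqrt 3"
proof (rule tendsto_sandwich)
  define \<kappa> where "\<kappa> n = sqrt 3 - 336 / (real n - 24)" for n
  have \<kappa>_pos: "0 < \<kappa> n" if "n \<ge> 360" for n
    using error_term_less_sqrt3[OF that] by (simp add: \<kappa>_def)
  have upper: "2 * FWP n P / MTSP n P \<le> 2 / \<kappa> n" if "n \<ge> 360" "MTSP n P > 0" for n P
    using FWP_le_MTSP[OF that(1), of P, folded \<kappa>_def] \<kappa>_pos[OF that(1)] that(2)
    by (simp add: field_simps)
  have bounds: "2 / sqrt 3 * (1 - 2 / real n) \<le> r n \<and> r n \<le> 2 / \<kappa> n" if n: "n \<ge> 360" for n
  proof -
    let ?X = "{2 * FWP n P / MTSP n P | P. MTSP n P > 0}"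
    \<comment> \<open>The triangle family has positive \<open>MTSP\<close>, so the set under the
      supremum is nonempty; \<open>upper\<close> bounds it from above.\<close>
    have "0 < \<kappa> n * FWP n triangle_vertex"
      using FWP_triangle_ge[of n] n \<kappa>_pos[OF n] by simp
    then have M: "MTSP n triangle_vertex > 0"
      using FWP_le_MTSP[OF n, of triangle_vertex, folded \<kappa>_def] by linarith
    have "r n \<le> 2 / \<kappa> n"
      unfolding r_def by (rule cSup_least) (use M upper[OF n] in auto)
    moreover have "bdd_above ?X"
      using upper[OF n] by (intro bdd_aboveI[of _ "2 / \<kappa> n"]) auto
    then have "2 * FWP n triangle_vertex / MTSP n triangle_vertex \<le> r n"
      unfolding r_def using M by (intro cSup_upper) auto
    \<comment> \<open>The left side is the quotient of the estimates \<open>FWP >= n - 2\<close> and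
      \<open>MTSP <= n * sqrt 3\<close> for the triangle.\<close>
    moreover have "2 / sqrt 3 * (1 - 2 / real n) = 2 * (real n - 2) / (real n * sqrt 3)"
      using n by (simp add: field_simps)
    moreover have "2 * (real n - 2) / (real n * sqrt 3) \<le> 2 * FWP n triangle_vertex / MTSP n triangle_vertex"
      using FWP_triangle_ge[of n] MTSP_triangle_le[of n] M n by (intro frac_le) auto
    ultimately show ?thesis by simp
  qed
  show "eventually (\<lambda>n. 2 / sqrt 3 * (1 - 2 / real n) \<le> r n) sequentially"
    using eventually_ge_at_top[of 360] by eventually_elim (use bounds in blast)
  show "eventually (\<lambda>n. r n \<le> 2 / \<kappa> n) sequentially"
    using eventually_ge_at_top[of 360] by eventually_elim (use bounds in blast)
  have "(\<lambda>n. 2 / sqrt 3 * (1 - 2 / real n)) \<longlonglongrightarrow> 2 / sqrt 3 * (1 - 0)"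
    by (intro tendsto_intros lim_const_over_n)
  then show "(\<lambda>n. 2 / sqrt 3 * (1 - 2 / real n)) \<longlonglongrightarrow> 2 / sqrt 3" by simp
  have "filterlim (\<lambda>n. -24 + real n) at_top sequentially"
    by (rule filterlim_tendsto_add_at_top[OF tendsto_const filterlim_real_sequentially])
  then have "(\<lambda>n. 336 / (-24 + real n)) \<longlonglongrightarrow> 0"
    by (intro tendsto_divide_0[OF tendsto_const] filterlim_at_top_imp_at_infinity)
  then have "(\<lambda>n. 2 / (sqrt 3 - 336 / (-24 + real n))) \<longlonglongrightarrow> 2 / (sqrt 3 - 0)"
    by (intro tendsto_intros) auto
  then show "(\<lambda>n. 2 / \<kappa> n) \<longlonglongrightarrow> 2 / sqrt 3" by (simp add: \<kappa>_def)
qed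

end
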